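(* Let $U\le S_d$, $V\le S_m$, $md=n$, and let $G=U\wr V$ be the wreath product acting on the variables $X_{i,j}$ ($1\le i\le d$, $1\le j\le m$). Let $N\unlhd U$ be a normal subgroup of index $2$, and let $E$ (a polynomial over $\mathbb{Z}$ in $d$ variables) be a $U$-relative $N$-invariant with the property that $E^u=-E$ for all $u\in U\setminus N$. Denote by $s_k$ the $k$-th elementary symmetric function on $m$ letters, and let $d_j:=E(X_{1,j},\dots,X_{d,j})$ for $1\le j\le m$. Then $G$ has a subgroup $H$ of index $2$ such that $$F(X_{1,1},\dots,X_{d,m}):=s_m(d_1,\dots,d_m)=d_1\cdots d_m$$ is a $G$-relative $H$-invariant.
   Context: The wreath product $U\wr V$ is the semidirect product $U^m\rtimes V$, where $V\le S_m$ permutes the $m$ copies of $U$; it acts imprimitively on the $X_{i,j}$: the $j$-th copy of $U\le S_d$ permutes the first indices of $X_{1,j},\dots,X_{d,j}$ and fixes all other variables, and $V$ permutes the second indices $j$. Permutation groups on variables act on polynomials over $\mathbb{Z}$ by permuting the variables; the image of $F$ under $\sigma$ is $F^\sigma$. For groups $H<G$ permuting variables, $F$ is a $G$-relative $H$-invariant if $\mathrm{Stab}_G(F)=\{\sigma\in G\mid F^\sigma=F\}=H$. *)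

theory Defs
  imports
    "HOL-Library.Poly_Mapping"
    "HOL-Algebra.Product_Groups"
    "HOL-Algebra.Sym_Groups"
begin

section \<open>Polynomials over the integers in variables of type \<open>'v\<close>\<close>

text \<open>A polynomial maps each monomial (a finitely supported exponent function) to its
  coefficient; the ring operations are those of \<^theory>\<open>HOL-Library.Poly_Mapping\<close>.\<close>

type_synonym 'v mpoly = "('v \<Rightarrow>\<^sub>0 nat) \<Rightarrow>\<^sub>0 int"

definition Var :: "'v \<Rightarrow> 'v mpoly" where
  "Var v = Poly_Mapping.single (Poly_Mapping.single v 1) 1"

definition vars :: "'v mpoly \<Rightarrow> 'v set" where
  "vars p = (\<Union>t\<in>Poly_Mapping.keys p. Poly_Mapping.keys t)"

text \<open>Substitution of \<open>g v\<close> for each variable \<open>v\<close>; the factor \<open>single 0 c\<close> is the constant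
  polynomial \<open>c\<close>.\<close>

definition subst :: "('v \<Rightarrow> 'w mpoly) \<Rightarrow> 'v mpoly \<Rightarrow> 'w mpoly" where
  "subst g p = (\<Sum>t\<in>Poly_Mapping.keys p.
     Poly_Mapping.single 0 (Poly_Mapping.lookup p t) *
     (\<Prod>v\<in>Poly_Mapping.keys t. g v ^ Poly_Mapping.lookup t v))"

definition permute_poly :: "('v \<Rightarrow> 'v) \<Rightarrow> 'v mpoly \<Rightarrow> 'v mpoly" where
  "permute_poly \<sigma> F = subst (\<lambda>v. Var (\<sigma> v)) F"

definition elem_sym_poly :: "nat \<Rightarrow> nat \<Rightarrow> nat mpoly" where
  "elem_sym_poly m k = (\<Sum>S | S \<subseteq> {1..m} \<and> card S = k. \<Prod>j\<in>S. Var j)"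

section \<open>Relative invariants\<close>

text \<open>The group \<open>G\<close> acts on the variables through \<open>act\<close>; for a group whose elements are already
  permutations of the variables, \<open>act\<close> is the identity.\<close>

definition relative_invariant ::
  "('g, 'x) monoid_scheme \<Rightarrow> ('g \<Rightarrow> 'v \<Rightarrow> 'v) \<Rightarrow> 'g set \<Rightarrow> 'v mpoly \<Rightarrow> bool" where
  "relative_invariant G act H F \<longleftrightarrow>
     subgroup H G \<and> {\<sigma> \<in> carrier G. permute_poly (act \<sigma>) F = F} = H"

section \<open>Wreath products of permutation groups\<close>

definition semidirect_product ::
  "('a, 'x) monoid_scheme \<Rightarrow> ('b, 'y) monoid_scheme \<Rightarrow> ('b \<Rightarrow> 'a \<Rightarrow> 'a) \<Rightarrow> ('a \<times> 'b) monoid" where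
  "semidirect_product A B \<phi> =
     \<lparr>carrier = carrier A \<times> carrier B,
      monoid.mult = (\<lambda>(a, b) (a', b'). (a \<otimes>\<^bsub>A\<^esub> \<phi> b a', b \<otimes>\<^bsub>B\<^esub> b')),
      one = (\<one>\<^bsub>A\<^esub>, \<one>\<^bsub>B\<^esub>)\<rparr>"

text \<open>\<open>v\<close> moves the \<open>j\<close>-th copy of \<open>U\<close> to the \<open>v j\<close>-th copy.\<close>

definition wreath_product ::
  "nat \<Rightarrow> nat \<Rightarrow> (nat \<Rightarrow> nat) set \<Rightarrow> (nat \<Rightarrow> nat) set \<Rightarrow> ((nat \<Rightarrow> nat \<Rightarrow> nat) \<times> (nat \<Rightarrow> nat)) monoid"
  where
  "wreath_product d m U V =
     semidirect_product
       (product_group {1..m} (\<lambda>j. (sym_group d)\<lparr>carrier := U\<rparr>))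
       ((sym_group m)\<lparr>carrier := V\<rparr>)
       (\<lambda>v u. \<lambda>j\<in>{1..m}. u (inv' v j))"

text \<open>The imprimitive action on the indices \<open>(i, j)\<close> of the variables: \<open>(u, v)\<close> is the product of
  \<open>u\<close> and \<open>v\<close> in the semidirect product, so \<open>v\<close> acts first on the second index, and then the
  component of \<open>u\<close> at the new second index acts on the first index.  Pairs outside
  \<open>{1..d} \<times> {1..m}\<close> are not indices of variables of interest and stay fixed.\<close>

definition wreath_act ::
  "nat \<Rightarrow> nat \<Rightarrow> (nat \<Rightarrow> nat \<Rightarrow> nat) \<times> (nat \<Rightarrow> nat) \<Rightarrow> nat \<times> nat \<Rightarrow> nat \<times> nat" where
  "wreath_act d m = (\<lambda>(u, v) (i, j).
     if i \<in> {1..d} \<and> j \<in> {1..m} then (u (v j) i, v j) else (i, j))"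

end

theory Submission
  imports Defs "HOL-Library.Product_Lexorder"
begin

text \<open>Each \<open>(u, v) \<in> U \<wr> V\<close> permutes the \<open>d\<^sub>j\<close> up to signs: it sends \<open>d\<^sub>j\<close> to \<open>\<plusminus>d\<^bsub>v j\<^esub>\<close>, the sign being
  that of \<open>u\<^bsub>v j\<^esub>\<close> under \<open>U / N \<cong> {1, -1}\<close>.  Hence it sends \<open>F = d\<^sub>1 \<cdots> d\<^sub>m\<close> to \<open>\<plusminus>F\<close>, and an element of
  \<open>U - N\<close> in a single component realises the sign \<open>-1\<close>.  As \<open>F \<noteq> 0\<close>, because polynomials over
  \<open>\<int>\<close> form a domain, the stabiliser of \<open>F\<close> is the kernel of a surjective sign character.\<close>

section \<open>Substitution in polynomials\<close>

text \<open>Setting the coefficient of a fresh monomial is the same as adding a single term, so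
  induction over finite maps becomes induction over sums of terms. Additive identities then only
  need checking on one term.\<close>

lemma mpoly_induct [case_names single add]:
  fixes p :: "'v mpoly"
  assumes single: "\<And>t c. P (Poly_Mapping.single t c)"
    and add: "\<And>p q. P p \<Longrightarrow> P q \<Longrightarrow> P (p + q)"
  shows "P p"
proof (induction p rule: Poly_Mapping.update_induct)
  case const
  show ?case using single[of 0 0] by simp
next
  case (update f t c)
  have "Poly_Mapping.update t c f = f + Poly_Mapping.single t c"
    using update.hyps
    by (intro poly_mapping_eqI)
       (auto simp: lookup_update lookup_add lookup_single when_def in_keys_iff)
  then show ?case
    using add[OF update.IH single] by simp
qed

definition monomial_subst :: "('v \<Rightarrow> 'w mpoly) \<Rightarrow> ('v \<Rightarrow>\<^sub>0 nat) \<Rightarrow> 'w mpoly" where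
  "monomial_subst g t = (\<Prod>v\<in>Poly_Mapping.keys t. g v ^ Poly_Mapping.lookup t v)"

text \<open>Outside \<open>keys t\<close> the exponent is 0 and the factor is 1. This lets two
  monomials share one index set in \<open>monomial_subst_add\<close>.\<close>

lemma monomial_subst_superset:
  assumes "finite A" "Poly_Mapping.keys t \<subseteq> A"
  shows "monomial_subst g t = (\<Prod>v\<in>A. g v ^ Poly_Mapping.lookup t v)"
  unfolding monomial_subst_def
  by (rule prod.mono_neutral_left) (use assms in \<open>auto simp: in_keys_iff\<close>)

lemma monomial_subst_zero [simp]: "monomial_subst g 0 = 1"
  by (simp add: monomial_subst_def)

lemma monomial_subst_add: "monomial_subst g (s + t) = monomial_subst g s * monomial_subst g t"
proof -
  let ?A = "Poly_Mapping.keys s \<union> Poly_Mapping.keys t"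
  have "monomial_subst g r = (\<Prod>v\<in>?A. g v ^ Poly_Mapping.lookup r v)"
    if "Poly_Mapping.keys r \<subseteq> ?A" for r
    by (rule monomial_subst_superset) (use that in auto)
  then show ?thesis
    using keys_add[of s t] by (simp add: lookup_add power_add prod.distrib)
qed

lemma subst_superset:
  assumes "finite A" "Poly_Mapping.keys p \<subseteq> A"
  shows "subst g p = (\<Sum>t\<in>A. Poly_Mapping.single 0 (Poly_Mapping.lookup p t) * monomial_subst g t)"
  unfolding subst_def monomial_subst_def [symmetric]
  by (rule sum.mono_neutral_left) (use assms in \<open>auto simp: in_keys_iff\<close>)

lemma subst_single: "subst g (Poly_Mapping.single t c) = Poly_Mapping.single 0 c * monomial_subst g t"
  by (subst subst_superset[of "{t}"]) auto

lemma subst_zero [simp]: "subst g 0 = 0"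
  by (simp add: subst_def)

lemma subst_one [simp]: "subst g 1 = 1"
  using subst_single[of g 0 1] by simp

lemma subst_Var [simp]: "subst g (Var v) = g v"
  by (simp add: Var_def subst_single monomial_subst_def)

lemma subst_add: "subst g (p + q) = subst g p + subst g q"
proof -
  let ?A = "Poly_Mapping.keys p \<union> Poly_Mapping.keys q"
  have "subst g r = (\<Sum>t\<in>?A. Poly_Mapping.single 0 (Poly_Mapping.lookup r t) * monomial_subst g t)"
    if "Poly_Mapping.keys r \<subseteq> ?A" for r
    by (rule subst_superset) (use that in auto)
  then show ?thesis
    using keys_add[of p q] by (simp add: lookup_add single_add distrib_right sum.distrib)
qed

lemma subst_uminus: "subst g (- p) = - subst g p"
  using subst_add[of g p "- p"] by (simp add: minus_unique)

text \<open>By additivity in both factors it is enough to multiply two single terms; there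
  coefficients multiply and exponents add.\<close>

lemma subst_mult:
  fixes g :: "'v \<Rightarrow> 'w mpoly"
  shows "subst g (p * q) = subst g p * subst g q"
proof (induction p rule: mpoly_induct)
  case (single s a)
  show ?case
  proof (induction q rule: mpoly_induct)
    case (single t b)
    \<comment> \<open>This splits the constant factor. The rule \<open>mult_single\<close> is
      instantiated with \<open>s\<close> below, since in general form it would merge the two
      constants again.\<close>
    have "Poly_Mapping.single (0 :: 'w \<Rightarrow>\<^sub>0 nat) (a * b) =
        Poly_Mapping.single 0 a * Poly_Mapping.single 0 b"
      by (simp add: mult_single)
    then show ?case
      by (simp add: mult_single[of s] subst_single monomial_subst_add mult.assoc mult.left_commute)
  next
    case (add p q)
    then show ?case by (simp add: distrib_left subst_add)
  qed
next
  case (add p q)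
  then show ?case by (simp add: distrib_right subst_add)
qed

lemma subst_power: "subst g (p ^ k) = subst g p ^ k"
  by (induction k) (simp_all add: subst_mult)

lemma subst_prod: "subst g (\<Prod>x\<in>A. f x) = (\<Prod>x\<in>A. subst g (f x))"
  by (induction A rule: infinite_finite_induct) (simp_all add: subst_mult)

text \<open>A substitution is a ring homomorphism fixing constants, so it can be pushed down to the
  variables.\<close>

lemma subst_subst: "subst g (subst h p) = subst (\<lambda>v. subst g (h v)) p"
proof (induction p rule: mpoly_induct)
  case (single t c)
  have "subst g (monomial_subst h t) = monomial_subst (\<lambda>v. subst g (h v)) t"
    by (simp add: monomial_subst_def subst_prod subst_power)
  then show ?case
    by (simp add: subst_single subst_mult)
next
  case (add p q)
  then show ?case by (simp add: subst_add)
qed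

text \<open>Used in \<open>permute_block\<close>, where two substitutions agree only on the indices
  that occur in \<open>E\<close>.\<close>

lemma subst_cong:
  assumes "\<And>v. v \<in> vars p \<Longrightarrow> g v = h v"
  shows "subst g p = subst h p"
  unfolding subst_def
  by (intro sum.cong prod.cong arg_cong2[where f = "(*)"] refl)
     (metis UN_I assms vars_def)

lemma Var_power: "Var v ^ k = Poly_Mapping.single (Poly_Mapping.single v k) 1"
  by (induction k) (simp_all add: Var_def mult_single flip: single_add)

lemma monomial_subst_Var: "monomial_subst Var t = Poly_Mapping.single t 1"
proof (induction t rule: Poly_Mapping.update_induct)
  case const
  show ?case by simp
next
  case (update t v k)
  have "Poly_Mapping.update v k t = t + Poly_Mapping.single v k"
    using update.hyps
    by (intro poly_mapping_eqI)
       (auto simp: lookup_update lookup_add lookup_single when_def in_keys_iff)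
  moreover have "monomial_subst Var (Poly_Mapping.single v k) =
      Poly_Mapping.single (Poly_Mapping.single v k) 1"
    using update.hyps by (simp add: monomial_subst_def Var_power)
  ultimately show ?case
    by (simp add: monomial_subst_add update.IH mult_single)
qed

lemma subst_Var_id: "subst Var p = p"
  by (induction p rule: mpoly_induct)
     (simp_all add: subst_single subst_add monomial_subst_Var mult_single)

text \<open>The variable \<open>v\<close> goes to \<open>\<sigma> (\<tau> v)\<close>, so this is a
  left action, in the same order as in \<open>wreath_act_mult\<close>.\<close>

lemma permute_poly_permute_poly: "permute_poly \<sigma> (permute_poly \<tau> F) = permute_poly (\<sigma> \<circ> \<tau>) F"
  by (simp add: permute_poly_def subst_subst)

lemma permute_poly_id: "permute_poly id F = F"
  by (simp add: permute_poly_def subst_Var_id)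

lemma permute_poly_uminus: "permute_poly \<sigma> (- F) = - permute_poly \<sigma> F"
  by (simp add: permute_poly_def subst_uminus)

lemma elem_sym_poly_top: "elem_sym_poly m m = (\<Prod>j\<in>{1..m}. Var j)"
proof -
  have "{S. S \<subseteq> {1..m} \<and> card S = m} = {{1..m}}"
    using card_subset_eq[of "{1..m}"] by auto
  then show ?thesis by (simp add: elem_sym_poly_def)
qed

text \<open>Each integer coefficient equals its own negative. Hence a nonzero \<open>F\<close> is
  never both fixed and negated.\<close>

lemma mpoly_eq_uminus_iff: "p = - p \<longleftrightarrow> p = 0" for p :: "'v mpoly"
proof
  assume "p = - p"
  then have "Poly_Mapping.lookup p t = - Poly_Mapping.lookup p t" for t
    by (metis lookup_uminus)
  then show "p = 0"
    by (intro poly_mapping_eqI) simp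
qed simp

section \<open>Sign characters and semidirect products\<close>

text \<open>By \<open>quot\<close> every element outside \<open>H\<close> lies in
  \<open>H #> g\<close>, so these two cosets exhaust the group; they differ since \<open>g\<close>
  is not in \<open>H\<close>.\<close>

lemma (in group) card_rcosets_eq_2:
  assumes H: "subgroup H G" and g: "g \<in> carrier G" "g \<notin> H"
    and quot: "\<And>x. x \<in> carrier G \<Longrightarrow> x \<notin> H \<Longrightarrow> x \<otimes> inv g \<in> H"
  shows "card (rcosets H) = 2"
proof -
  have one: "H #> x = H" if "x \<in> H" for x
    using that H subgroup.mem_carrier[OF H] by (simp add: coset_join2)
  have other: "H #> x = H #> g" if "x \<in> carrier G" "x \<notin> H" for x
  proof -
    have "x \<in> H #> g"
      using quot[OF that] that(1) g(1) H by (intro subgroup.rcos_module_rev) (auto intro: group_axioms)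
    then show ?thesis
      using repr_independence[of x H g] g(1) H by simp
  qed
  have "g \<in> H #> g"
    using rcos_self[OF g(1) H] .
  then have ne: "H #> g \<noteq> H"
    using g(2) by auto
  have "rcosets H = {H, H #> g}"
  proof
    show "rcosets H \<subseteq> {H, H #> g}"
      unfolding RCOSETS_def using one other by blast
    show "{H, H #> g} \<subseteq> rcosets H"
      using subgroup.subgroup_in_rcosets[OF H group_axioms] rcosetsI[OF subgroup.subset[OF H] g(1)]
      by simp
  qed
  then show ?thesis using ne by simp
qed

text \<open>Compared with the index 2 of \<open>N\<close>, this yields
  \<open>N \<noteq> U\<close>.\<close>

lemma (in group) card_rcosets_carrier: "card (rcosets (carrier G)) = 1"
proof -
  have "rcosets (carrier G) = {carrier G}"
    unfolding RCOSETS_def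
    using subgroup_self by (auto simp: coset_join2)
  then show ?thesis by simp
qed

text \<open>The sign is multiplicative because negation commutes with permuting variables. It is
  never introduced as a map: products, inverses and cosets are settled by their effect on
  \<open>F\<close>.\<close>

lemma (in group) stabiliser_of_sign_character:
  assumes act_mult: "\<And>x y. x \<in> carrier G \<Longrightarrow> y \<in> carrier G \<Longrightarrow> act (x \<otimes> y) = act x \<circ> act y"
    and act_one: "act \<one> = id"
    and sign: "\<And>x. x \<in> carrier G \<Longrightarrow> permute_poly (act x) F = F \<or> permute_poly (act x) F = - F"
    and g: "g \<in> carrier G" "permute_poly (act g) F = - F"
    and "F \<noteq> 0"
  shows "\<exists>H. subgroup H G \<and> card (rcosets H) = 2 \<and> relative_invariant G act H F"
proof -
  define H where "H = {x \<in> carrier G. permute_poly (act x) F = F}"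
  have mult: "permute_poly (act (x \<otimes> y)) F = permute_poly (act x) (permute_poly (act y) F)"
    if "x \<in> carrier G" "y \<in> carrier G" for x y
    using that by (simp add: act_mult permute_poly_permute_poly)
  have neg: "permute_poly (act x) F \<noteq> F" if "permute_poly (act x) F = - F" for x
    using that \<open>F \<noteq> 0\<close> mpoly_eq_uminus_iff[of F] by simp
  have inv_neg: "permute_poly (act (inv x)) F = F \<longleftrightarrow> permute_poly (act x) F = F"
    if x: "x \<in> carrier G" for x
  proof -
    \<comment> \<open>If \<open>x\<close> negates \<open>F\<close>, its inverse sends
      \<open>- F\<close> back to \<open>F\<close> and therefore cannot fix \<open>F\<close>.\<close>
    have "permute_poly (act (inv x)) (permute_poly (act x) F) = F"
      using mult[of "inv x" x] x by (simp add: act_one permute_poly_id)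
    then show ?thesis
      using sign[OF x] sign[of "inv x"] neg x by (metis permute_poly_uminus inv_closed minus_minus)
  qed
  have H: "subgroup H G"
  proof (rule subgroupI)
    have "\<one> \<in> H"
      by (simp add: H_def act_one permute_poly_id)
    then show "H \<noteq> {}" by auto
  qed (auto simp: H_def mult inv_neg)
  have "card (rcosets H) = 2"
  proof (rule card_rcosets_eq_2[OF H g(1)])
    show "g \<notin> H"
      using neg[OF g(2)] by (simp add: H_def)
    show "x \<otimes> inv g \<in> H" if x: "x \<in> carrier G" "x \<notin> H" for x
    proof -
      \<comment> \<open>Both \<open>x\<close> and \<open>inv g\<close> negate \<open>F\<close>, so
        their product fixes it.\<close>
      have "permute_poly (act (inv g)) F = - F"
        using inv_neg[OF g(1)] neg[OF g(2)] sign[of "inv g"] g(1) by auto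
      moreover have "permute_poly (act x) F = - F"
        using sign[OF x(1)] x by (auto simp: H_def)
      ultimately show ?thesis
        using x g(1) by (simp add: H_def mult permute_poly_uminus)
    qed
  qed
  with H show ?thesis
    by (auto simp: relative_invariant_def H_def)
qed

section \<open>Semidirect products as groups\<close>

lemma semidirect_product_simps:
  "carrier (semidirect_product A B \<phi>) = carrier A \<times> carrier B"
  "(a, b) \<otimes>\<^bsub>semidirect_product A B \<phi>\<^esub> (a', b') = (a \<otimes>\<^bsub>A\<^esub> \<phi> b a', b \<otimes>\<^bsub>B\<^esub> b')"
  "\<one>\<^bsub>semidirect_product A B \<phi>\<^esub> = (\<one>\<^bsub>A\<^esub>, \<one>\<^bsub>B\<^esub>)"
  by (simp_all add: semidirect_product_def)

lemma group_semidirect_product: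
  assumes "group A" "group B"
    and hom: "\<And>b. b \<in> carrier B \<Longrightarrow> \<phi> b \<in> hom A A"
    and phi_mult: "\<And>b c a. b \<in> carrier B \<Longrightarrow> c \<in> carrier B \<Longrightarrow> a \<in> carrier A \<Longrightarrow>
        \<phi> (b \<otimes>\<^bsub>B\<^esub> c) a = \<phi> b (\<phi> c a)"
    and phi_one: "\<And>a. a \<in> carrier A \<Longrightarrow> \<phi> \<one>\<^bsub>B\<^esub> a = a"
  shows "group (semidirect_product A B \<phi>)"
proof -
  interpret A: group A by fact
  interpret B: group B by fact
  have closed: "\<phi> b a \<in> carrier A" if "b \<in> carrier B" "a \<in> carrier A" for a b
    using hom that by (auto simp: hom_def)
  have phi_hom: "\<phi> b (a \<otimes>\<^bsub>A\<^esub> a') = \<phi> b a \<otimes>\<^bsub>A\<^esub> \<phi> b a'"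
    if "b \<in> carrier B" "a \<in> carrier A" "a' \<in> carrier A" for a a' b
    using hom that by (auto simp: hom_def)
  show ?thesis
  proof (rule groupI, unfold semidirect_product_simps)
    fix x assume x: "x \<in> carrier A \<times> carrier B"
    then obtain a b where [simp]: "x = (a, b)" and ab: "a \<in> carrier A" "b \<in> carrier B"
      by auto
    \<comment> \<open>The left inverse of \<open>(a, b)\<close> must have second component the
      inverse of \<open>b\<close>; twisting the inverse of \<open>a\<close> by it makes the first
      component collapse to the image of the identity.\<close>
    have "\<phi> (inv\<^bsub>B\<^esub> b) (inv\<^bsub>A\<^esub> a) \<otimes>\<^bsub>A\<^esub> \<phi> (inv\<^bsub>B\<^esub> b) a = \<phi> (inv\<^bsub>B\<^esub> b) \<one>\<^bsub>A\<^esub>"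
      using ab by (simp flip: phi_hom)
    also have "\<dots> = \<one>\<^bsub>A\<^esub>"
      using ab hom[of "inv\<^bsub>B\<^esub> b"] hom_one[of "\<phi> (inv\<^bsub>B\<^esub> b)" A A] by (simp add: assms)
    finally show "\<exists>y\<in>carrier A \<times> carrier B. y \<otimes>\<^bsub>semidirect_product A B \<phi>\<^esub> x = (\<one>\<^bsub>A\<^esub>, \<one>\<^bsub>B\<^esub>)"
      using ab closed
      by (intro bexI[of _ "(\<phi> (inv\<^bsub>B\<^esub> b) (inv\<^bsub>A\<^esub> a), inv\<^bsub>B\<^esub> b)"])
         (auto simp: semidirect_product_simps)
  qed (auto simp: semidirect_product_simps closed phi_hom phi_mult phi_one A.m_assoc B.m_assoc)
qed

section \<open>Wreath products\<close>

locale wreath_data =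
  fixes d m :: nat and U V :: "(nat \<Rightarrow> nat) set"
  assumes U: "subgroup U (sym_group d)" and V: "subgroup V (sym_group m)"
begin

lemma U_permutes: "u \<in> U \<Longrightarrow> u permutes {1..d}"
  using subgroup.mem_carrier[OF U] by (simp add: sym_group_carrier)

lemma V_permutes: "v \<in> V \<Longrightarrow> v permutes {1..m}"
  using subgroup.mem_carrier[OF V] by (simp add: sym_group_carrier)

lemma group_U: "group ((sym_group d)\<lparr>carrier := U\<rparr>)"
  using group.subgroup_imp_group[OF sym_group_is_group U] .

lemma id_in_U: "id \<in> U"
  using subgroup.one_closed[OF U] by (simp add: sym_group_one)

lemma id_in_V: "id \<in> V"
  using subgroup.one_closed[OF V] by (simp add: sym_group_one)

lemma comp_in_U: "u \<in> U \<Longrightarrow> u' \<in> U \<Longrightarrow> u \<circ> u' \<in> U"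
  using subgroup.m_closed[OF U] by (simp add: sym_group_mult)

lemma carrier_wreath: "carrier (wreath_product d m U V) = ({1..m} \<rightarrow>\<^sub>E U) \<times> V"
  by (simp add: wreath_product_def semidirect_product_simps)

lemma mult_wreath:
  "(u, v) \<otimes>\<^bsub>wreath_product d m U V\<^esub> (u', v') =
     (\<lambda>j\<in>{1..m}. u j \<circ> (\<lambda>j\<in>{1..m}. u' (inv' v j)) j, v \<circ> v')"
  by (simp add: wreath_product_def semidirect_product_simps sym_group_mult)

lemma one_wreath: "\<one>\<^bsub>wreath_product d m U V\<^esub> = (\<lambda>j\<in>{1..m}. id, id)"
  by (simp add: wreath_product_def semidirect_product_simps sym_group_one)

lemma group_wreath: "group (wreath_product d m U V)"
  unfolding wreath_product_def
proof (rule group_semidirect_product, goal_cases)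
  case 1
  show ?case using group_U by simp
next
  case 2
  show ?case using group.subgroup_imp_group[OF sym_group_is_group V] .
next
  case (3 v)
  then have "inv' v permutes {1..m}"
    using permutes_inv[OF V_permutes] by simp
  then have "inv' v j \<in> {1..m}" if "j \<in> {1..m}" for j
    using permutes_in_image that by metis
  then show ?case
    by (auto simp: hom_def sym_group_mult PiE_iff comp_in_U intro!: restrict_ext)
next
  case (4 v w u)
  then have vw: "v permutes {1..m}" "w permutes {1..m}"
    using V_permutes by simp_all
  \<comment> \<open>Precomposing tuples with a permutation reverses products; the inverse reverses
    them once more, which gives a left action of \<open>V\<close>.\<close>
  have "inv' (v \<circ> w) = inv' w \<circ> inv' v"
    using vw by (simp add: o_inv_distrib permutes_bij)
  moreover have "inv' v j \<in> {1..m}" if "j \<in> {1..m}" for j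
    using permutes_in_image[OF permutes_inv[OF vw(1)]] that by blast
  ultimately show ?case
    by (auto simp: sym_group_mult intro!: restrict_ext)
next
  case (5 u)
  \<comment> \<open>Tuples are \<open>undefined\<close> outside \<open>{1..m}\<close>, so
    restricting one to that range returns the same function.\<close>
  then show ?case
    by (auto simp: sym_group_one PiE_iff extensional_def restrict_def)
qed

lemma wreath_act_one: "wreath_act d m \<one>\<^bsub>wreath_product d m U V\<^esub> = id"
  by (auto simp: wreath_act_def one_wreath fun_eq_iff)

lemma wreath_act_mult:
  assumes "x \<in> carrier (wreath_product d m U V)" "y \<in> carrier (wreath_product d m U V)"
  shows "wreath_act d m (x \<otimes>\<^bsub>wreath_product d m U V\<^esub> y) = wreath_act d m x \<circ> wreath_act d m y"
proof -
  obtain u v u' v' where xy: "x = (u, v)" "y = (u', v')"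
    and u: "u \<in> {1..m} \<rightarrow>\<^sub>E U" "u' \<in> {1..m} \<rightarrow>\<^sub>E U" and v: "v \<in> V" "v' \<in> V"
    using assms by (auto simp: carrier_wreath)
  \<comment> \<open>By \<open>vp\<close> and \<open>up\<close> the action of \<open>y\<close> keeps
    a pair in range, so the action of \<open>x\<close> does not fall into its fixing branch.\<close>
  have vp: "v k \<in> {1..m}" "v' k \<in> {1..m}" if "k \<in> {1..m}" for k
    using V_permutes[OF v(1)] V_permutes[OF v(2)] that by (metis permutes_in_image)+
  have up: "u' k i \<in> {1..d}" if "k \<in> {1..m}" "i \<in> {1..d}" for k i
    using U_permutes[of "u' k"] u that permutes_in_image[of "u' k" "{1..d}" i] by (auto simp: PiE_iff)
  \<comment> \<open>At the new second index \<open>v (v' j)\<close> the twisted tuple has component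
    \<open>u' (inv' v (v (v' j)))\<close>, which must be the \<open>u' (v' j)\<close> that
    \<open>y\<close> applies.\<close>
  have inv: "inv' v (v k) = k" for k
    using V_permutes[OF v(1)] by (simp add: permutes_inverses)
  have "wreath_act d m (x \<otimes>\<^bsub>wreath_product d m U V\<^esub> y) (i, j) =
      (wreath_act d m x \<circ> wreath_act d m y) (i, j)" for i j
  proof (cases "i \<in> {1..d} \<and> j \<in> {1..m}")
    case True
    then have j: "j \<in> {1..m}" "v' j \<in> {1..m}" "v (v' j) \<in> {1..m}" and i: "i \<in> {1..d}"
        "u' (v' j) i \<in> {1..d}"
      using vp up by blast+
    then show ?thesis
      by (simp add: xy mult_wreath wreath_act_def inv del: atLeastAtMost_iff)
  next
    case False
    then show ?thesis
      by (auto simp: xy mult_wreath wreath_act_def)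
  qed
  then show ?thesis by (auto simp: fun_eq_iff)
qed

text \<open>The variable \<open>(i, j)\<close> goes to \<open>(u (v j) i, v j)\<close>: the block
  index moves, and the first index is permuted by the component at the new block. The bound on
  \<open>vars E\<close> keeps all occurring pairs in range.\<close>

lemma permute_block:
  assumes "u \<in> {1..m} \<rightarrow>\<^sub>E U" "v \<in> V" "j \<in> {1..m}" "vars E \<subseteq> {1..d}"
  shows "permute_poly (wreath_act d m (u, v)) (subst (\<lambda>i. Var (i, j)) E) =
    subst (\<lambda>i. Var (i, v j)) (permute_poly (u (v j)) E)"
  unfolding permute_poly_def subst_subst
  by (rule subst_cong) (use assms in \<open>auto simp: wreath_act_def\<close>)

end

section \<open>The stabiliser of the product of the block copies of \<open>E\<close>\<close>

theorem theorem5p7: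
  fixes n d m :: nat
    and U V N :: "(nat \<Rightarrow> nat) set"
    and E :: "nat mpoly"
    and G :: "((nat \<Rightarrow> nat \<Rightarrow> nat) \<times> (nat \<Rightarrow> nat)) monoid"
    and dd :: "nat \<Rightarrow> (nat \<times> nat) mpoly"
    and F :: "(nat \<times> nat) mpoly"
  assumes "n \<ge> 1" and "m * d = n"
    and U: "subgroup U (sym_group d)"
    and V: "subgroup V (sym_group m)"
    and G: "G = wreath_product d m U V"
    and N: "N \<lhd> (sym_group d)\<lparr>carrier := U\<rparr>"
    and index_N: "card (rcosets\<^bsub>(sym_group d)\<lparr>carrier := U\<rparr>\<^esub> N) = 2"
    and vars_E: "vars E \<subseteq> {1..d}"
    and E_invariant: "relative_invariant ((sym_group d)\<lparr>carrier := U\<rparr>) (\<lambda>u. u) N E"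
    and E_minus: "\<And>u. u \<in> U - N \<Longrightarrow> permute_poly u E = - E"
    and dd: "\<And>j. j \<in> {1..m} \<Longrightarrow> dd j = subst (\<lambda>i. Var (i, j)) E"
    and F: "F = subst dd (elem_sym_poly m m)"
  shows "F = (\<Prod>j\<in>{1..m}. dd j) \<and>
    (\<exists>H. subgroup H G \<and> card (rcosets\<^bsub>G\<^esub> H) = 2 \<and>
         relative_invariant G (wreath_act d m) H F)"
proof
  interpret wreath_data d m U V
    using U V by (rule wreath_data.intro)
  interpret G: group G
    unfolding G by (rule group_wreath)
  show F_eq: "F = (\<Prod>j\<in>{1..m}. dd j)"
    by (simp add: F elem_sym_poly_top subst_prod)
  have fixed: "{u \<in> U. permute_poly u E = E} = N"
    using E_invariant by (simp add: relative_invariant_def)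
  have "N \<noteq> U"
    using index_N group.card_rcosets_carrier[OF group_U] by auto
  then obtain w where w: "w \<in> U" "w \<notin> N"
    using fixed by auto
  \<comment> \<open>The zero polynomial would be fixed by \<open>w\<close>, which lies outside the
    stabiliser \<open>N\<close>.\<close>
  then have "E \<noteq> 0"
    using fixed by (auto simp: permute_poly_def)
  have U_sign: "permute_poly u E = E \<or> permute_poly u E = - E" if "u \<in> U" for u
    using E_minus[of u] fixed that by (cases "u \<in> N") auto
  have "m \<ge> 1"
    using assms(1,2) by (cases m) auto
  have "dd j \<noteq> 0" if "j \<in> {1..m}" for j
  proof
    assume "dd j = 0"
    \<comment> \<open>Forgetting the block index turns \<open>dd j\<close> back into
      \<open>E\<close>.\<close>
    then have "subst (\<lambda>v. Var (fst v)) (subst (\<lambda>i. Var (i, j)) E) = 0"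
      using dd[OF that] by simp
    then show False
      using \<open>E \<noteq> 0\<close> by (simp add: subst_subst subst_Var_id)
  qed
  \<comment> \<open>A product of nonzero factors in a domain; the domain property rests on a linear
    order of the variables, here the lexicographic order on index pairs.\<close>
  then have "F \<noteq> 0"
    by (simp add: F_eq)
  have permute_F: "permute_poly (wreath_act d m (u, v)) F =
      (\<Prod>j\<in>{1..m}. subst (\<lambda>i. Var (i, j)) (permute_poly (u j) E))"
    if "u \<in> {1..m} \<rightarrow>\<^sub>E U" "v \<in> V" for u v
  proof -
    have "permute_poly (wreath_act d m (u, v)) F =
        (\<Prod>j\<in>{1..m}. permute_poly (wreath_act d m (u, v)) (dd j))"
      by (simp add: F_eq permute_poly_def subst_prod)
    also have "\<dots> = (\<Prod>j\<in>{1..m}. subst (\<lambda>i. Var (i, v j)) (permute_poly (u (v j)) E))"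
      using that vars_E by (intro prod.cong) (simp_all add: dd permute_block)
    \<comment> \<open>The permutation \<open>v\<close> only reorders the factors, so it contributes
      no sign.\<close>
    also have "\<dots> = (\<Prod>j\<in>{1..m}. subst (\<lambda>i. Var (i, j)) (permute_poly (u j) E))"
      using permutes_imp_bij[OF V_permutes[OF that(2)]] by (rule prod.reindex_bij_betw)
    finally show ?thesis .
  qed
  \<comment> \<open>Stated for all subsets \<open>A\<close> so that the signs can be collected one
    factor at a time.\<close>
  have sign_prod: "(\<Prod>j\<in>A. subst (\<lambda>i. Var (i, j)) (permute_poly (u j) E)) \<in>
      {\<Prod>j\<in>A. dd j, - (\<Prod>j\<in>A. dd j)}"
    if "A \<subseteq> {1..m}" "u \<in> {1..m} \<rightarrow>\<^sub>E U" for u A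
    using finite_subset[OF that(1) finite_atLeastAtMost] that(1)
  proof (induction A rule: finite_induct)
    case (insert j A)
    have "u j \<in> U"
      using insert.prems that(2) by (auto simp: PiE_iff)
    then have "subst (\<lambda>i. Var (i, j)) (permute_poly (u j) E) \<in> {dd j, - dd j}"
      using U_sign[of "u j"] insert.prems by (auto simp: dd subst_uminus)
    with insert show ?case by auto
  qed simp
  have sign_F: "permute_poly (wreath_act d m x) F = F \<or> permute_poly (wreath_act d m x) F = - F"
    if x: "x \<in> carrier G" for x
  proof -
    obtain u v where "x = (u, v)" "u \<in> {1..m} \<rightarrow>\<^sub>E U" "v \<in> V"
      using x by (auto simp: G carrier_wreath)
    then show ?thesis
      using sign_prod[OF order.refl, of u] permute_F[of u v] by (simp add: F_eq)
  qed
  \<comment> \<open>One sign change in block 1, which exists because \<open>m \<ge> 1\<close>; the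
    blocks themselves are not moved.\<close>
  define g where "g = ((\<lambda>j\<in>{1..m}. if j = 1 then w else id), id :: nat \<Rightarrow> nat)"
  have g: "g \<in> carrier G"
    using w id_in_U id_in_V by (auto simp: g_def G carrier_wreath)
  have "permute_poly (wreath_act d m g) F =
      (\<Prod>j\<in>{1..m}. subst (\<lambda>i. Var (i, j)) (permute_poly (fst g j) E))"
    using g permute_F[of "fst g" "snd g"] by (auto simp: G carrier_wreath)
  also have "\<dots> = (\<Prod>j\<in>{1..m}. (if j = 1 then -1 else 1) * dd j)"
    using E_minus[of w] w by (intro prod.cong) (auto simp: g_def dd subst_uminus permute_poly_id)
  also have "\<dots> = - F"
    using \<open>m \<ge> 1\<close> by (simp add: prod.distrib F_eq)
  finally show "\<exists>H. subgroup H G \<and> card (rcosets\<^bsub>G\<^esub> H) = 2 \<and>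
         relative_invariant G (wreath_act d m) H F"
    using G.stabiliser_of_sign_character[of "wreath_act d m" F g] sign_F g \<open>F \<noteq> 0\<close>
    by (simp add: G wreath_act_mult wreath_act_one)
qed

end
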